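(* Let $X$ and $\overline{Y}$ be Banach spaces, $T:X\to\overline{Y}$ a linear operator, $p\ge1$, $\ell\in\overline{Y}$, and let $u\in X$ satisfy $Tu=\ell$. Assume that $u$ is also the unique minimiser over $X$ of the relaxed functional $v\mapsto\|Tv-\ell\|_{\overline{Y}}$. Set $\mathscr{J}(v)=\|Tv-\ell\|_{\overline{Y}}^p$ for $v\in X$. Let $\mathcal{N}\subset X$ be a nonempty set with closure $\operatorname{cl}(\mathcal{N})$ in $X$, let $\tilde{\mathscr{J}}:\operatorname{cl}(\mathcal{N})\to\mathbb{R}$ be an approximate loss functional, and let $0\le\varepsilon_{\mathrm{rel}}<1$, $\varepsilon_{\mathrm{opt}}\ge0$. Let $\mathcal{M}(\tilde{\mathscr{J}})$ be the set of minimisers of $\tilde{\mathscr{J}}$ over $\operatorname{cl}(\mathcal{N})$ (assumed nonempty). Assume that $$|\mathscr{J}(v)-\tilde{\mathscr{J}}(v)|\le\varepsilon_{\mathrm{rel}}\,\mathscr{J}(v)\qquad\forall v\in\mathcal{N},$$ and that $\tilde u\in\mathcal{N}$ (the output of the optimisation algorithm) satisfies $$\min_{v\in\mathcal{M}(\tilde{\mathscr{J}})}|\tilde{\mathscr{J}}(\tilde u)-\tilde{\mathscr{J}}(v)|\le\varepsilon_{\mathrm{opt}} .$$ Then $$\|T\tilde u-Tu\|_{\overline{Y}}^p\le\frac{1}{1-\varepsilon_{\mathrm{rel}}}\Big((1+\varepsilon_{\mathrm{rel}})\inf_{w\in\mathcal{N}}\|Tu-Tw\|_{\overline{Y}}^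p+\varepsilon_{\mathrm{opt}}\Big).$$
   Context: The space $\overline{Y}$ replaces the natural residual space $Y$ of the original problem $Tu=\ell$ by a larger space with a weaker norm, so that no upper bound of $\|Tv\|_{\overline{Y}}$ by $\|v\|_X$ and no lower bound of $\|Tv\|_{\overline{Y}}$ in terms of $\|v\|_X$ are assumed. In the application, $\mathcal{N}$ is the set of functions in $X$ realised by a neural network of a fixed architecture. The number $\varepsilon_{\mathrm{rel}}$ is the relative perturbation (quadrature) error and $\varepsilon_{\mathrm{opt}}$ the optimisation error. *)

theory Defs
  imports "HOL-Analysis.Analysis"
begin

definition residual_loss :: "('a::banach \<Rightarrow> 'b::banach) \<Rightarrow> 'b \<Rightarrow> real \<Rightarrow> 'a \<Rightarrow> real" where
  "residual_loss T l p v = norm (T v - l) powr p"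

definition minimisers :: "('a \<Rightarrow> real) \<Rightarrow> 'a set \<Rightarrow> 'a set" where
  "minimisers f S = {v. is_arg_min f (\<lambda>w. w \<in> S) v}"

end

theory Submission imports Defs begin

text \<open>
  The relative perturbation bound traps the approximate loss between
  \<open>(1 - eps_rel) J\<close> and \<open>(1 + eps_rel) J\<close> on \<open>N\<close>.  Minimising over the closure can only lower
  the minimum value, so for every \<open>w \<in> N\<close>
  \<open>(1 - eps_rel) J ut \<le> Jt ut \<le> min Jt + eps_opt \<le> Jt w + eps_opt \<le> (1 + eps_rel) J w + eps_opt\<close>.
  As the left-hand side does not depend on \<open>w\<close>, passing to the infimum over \<open>w\<close> and dividing by
  \<open>1 - eps_rel > 0\<close> gives the claim.  A minimiser may lie outside \<open>N\<close>, where the two losses are not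
  related, so the perturbation bound is applied only at \<open>ut\<close> and \<open>w\<close>.
\<close>

lemma minimiser_le:
  fixes f :: "'a \<Rightarrow> real"
  assumes "v \<in> minimisers f S" "w \<in> S"
  shows "f v \<le> f w"
  using assms by (auto simp: minimisers_def is_arg_min_linorder)

text \<open>
  All minimisers share one value, so the distance from \<open>f x\<close> to that value is the same for each of
  them and the infimum of these distances is just the optimality gap of \<open>x\<close>.
\<close>

lemma INF_minimisers_gap:
  fixes f :: "'a \<Rightarrow> real"
  assumes v: "v \<in> minimisers f S" and x: "x \<in> S"
  shows "(INF v'\<in>minimisers f S. \<bar>f x - f v'\<bar>) = f x - f v"
proof -
  have "\<bar>f x - f v'\<bar> = f x - f v" if v': "v' \<in> minimisers f S" for v'
  proof -
    have "v \<in> S" "v' \<in> S"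
      using v v' by (auto simp: minimisers_def is_arg_min_linorder)
    then have "f v' = f v"
      using minimiser_le[OF v] minimiser_le[OF v'] by (meson order_antisym)
    then show ?thesis
      using minimiser_le[OF v x] by simp
  qed
  then have "(INF v'\<in>minimisers f S. \<bar>f x - f v'\<bar>) = (INF v'\<in>minimisers f S. f x - f v)"
    by (intro INF_cong) auto
  also have "\<dots> = f x - f v"
    using v by (intro cINF_const) auto
  finally show ?thesis .
qed

theorem corollary3p2:
  fixes T :: "'a::banach \<Rightarrow> 'b::banach"
    and l :: 'b and u ut :: 'a and p :: real
    and N :: "'a set" and Jt :: "'a \<Rightarrow> real"
    and eps_rel eps_opt :: real
  assumes "linear T"
    and "p \<ge> 1"
    and "T u = l"
    and "minimisers (\<lambda>v. norm (T v - l)) UNIV = {u}"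
    and "N \<noteq> {}"
    and "0 \<le> eps_rel" and "eps_rel < 1" and "eps_opt \<ge> 0"
    and "minimisers Jt (closure N) \<noteq> {}"
    and "\<forall>v\<in>N. \<bar>residual_loss T l p v - Jt v\<bar> \<le> eps_rel * residual_loss T l p v"
    and "ut \<in> N"
    and "(INF v\<in>minimisers Jt (closure N). \<bar>Jt ut - Jt v\<bar>) \<le> eps_opt"
  shows "norm (T ut - T u) powr p
           \<le> 1 / (1 - eps_rel) * ((1 + eps_rel) * (INF w\<in>N. norm (T u - T w) powr p) + eps_opt)"
proof -
  define J where "J = residual_loss T l p"
  have J_eq: "J w = norm (T u - T w) powr p" for w
    using assms(3) by (simp add: J_def residual_loss_def norm_minus_commute)
  obtain v where v: "v \<in> minimisers Jt (closure N)"
    using assms(9) by blast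
  have pert: "\<bar>J w - Jt w\<bar> \<le> eps_rel * J w" if "w \<in> N" for w
    using assms(10) that by (simp add: J_def)
  have in_closure: "w \<in> closure N" if "w \<in> N" for w
    using that closure_subset by blast
  have gap: "Jt ut - Jt v \<le> eps_opt"
    using assms(12) INF_minimisers_gap[OF v in_closure[OF assms(11)]] by simp
  have bound: "(1 - eps_rel) * J ut \<le> (1 + eps_rel) * J w + eps_opt" if w: "w \<in> N" for w
  proof -
    have "(1 - eps_rel) * J ut \<le> Jt ut"
      using pert[OF assms(11)] by (simp add: algebra_simps)
    also have "\<dots> \<le> Jt w + eps_opt"
      using gap minimiser_le[OF v in_closure[OF w]] by linarith
    also have "Jt w \<le> (1 + eps_rel) * J w"
      using pert[OF w] by (simp add: algebra_simps)
    finally show ?thesis by simp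
  qed
  \<comment> \<open>The bound is solved for \<open>J w\<close>, so that a constant lies below every term of the infimum.\<close>
  have "((1 - eps_rel) * J ut - eps_opt) / (1 + eps_rel) \<le> (INF w\<in>N. J w)"
  proof (rule cINF_greatest[OF assms(5)])
    fix w assume "w \<in> N"
    then show "((1 - eps_rel) * J ut - eps_opt) / (1 + eps_rel) \<le> J w"
      using bound[of w] assms(6) by (simp add: pos_divide_le_eq mult.commute)
  qed
  then have "(1 - eps_rel) * J ut \<le> (1 + eps_rel) * (INF w\<in>N. J w) + eps_opt"
    using assms(6) by (simp add: pos_divide_le_eq mult.commute)
  then have "J ut \<le> 1 / (1 - eps_rel) * ((1 + eps_rel) * (INF w\<in>N. J w) + eps_opt)"
    using assms(7) by (simp add: pos_le_divide_eq mult.commute)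
  then show ?thesis
    by (simp add: J_eq norm_minus_commute)
qed

end
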